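(* For every $j\in\mathbb Z$, the one-dimensional central-upwind (CU) scheme described in the context admits the decomposition $$ \begin{aligned} \overline{\mathbf u}^{\,n+1}_j={}&\Big(\tfrac12-\lambda^n\big(\sigma^+_{j-\frac12}-\sigma^-_{j-\frac12}\big)\Big)\mathbf u^+_{j-\frac12}+\lambda^n\sigma^+_{j-\frac12}\mathbf u^{*,-}_{j-\frac12}\\ &+\Big(\tfrac12-\lambda^n\big(\sigma^+_{j+\frac12}-\sigma^-_{j+\frac12}\big)\Big)\mathbf u^-_{j+\frac12}-\lambda^n\sigma^-_{j+\frac12}\mathbf u^{*,+}_{j+\frac12}+\lambda^n\big(\sigma^+_{j+\frac12}-\sigma^-_{j-\frac12}\big)\,\mathbf u_j^*, \end{aligned} $$ and this is a convex combination (all five coefficients are nonnegative and sum to $1$) under the CFL condition $$\lambda^n\sigma\le\tfrac12,\qquad \sigma:=\max_j\big\{\sigma^+_{j+\frac12}-\sigma^-_{j+\frac12}\big\}.$$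
   Context: Consider a 1-D hyperbolic system of conservation laws $\mathbf u_t+\mathbf f(\mathbf u)_x=\mathbf 0$ with $\mathbf u\in\mathbb R^m$. Let $\lambda_1(\mathbf u)$ and $\lambda_m(\mathbf u)$ be the smallest and largest eigenvalues of $\partial\mathbf f/\partial\mathbf u$. Given $\Delta x,\Delta t^n>0$, $\lambda^n:=\Delta t^n/\Delta x$, and cell averages $\overline{\mathbf u}_j^{\,n}\in\mathbb R^m$, $j\in\mathbb Z$ (all point values below are assumed to lie in the domain where $\mathbf f$ and the eigenvalues are defined), the CU scheme is $$\overline{\mathbf u}^{\,n+1}_j=\overline{\mathbf u}^{\,n}_j-\lambda^n\big(\hat{\mathbf f}_{j+\frac12}-\hat{\mathbf f}_{j-\frac12}\big),$$ $$\hat{\mathbf f}_{j+\frac12}=\frac{\sigma^+_{j+\frac12}\mathbf f(\mathbf u^-_{j+\frac12})-\sigma^-_{j+\frac12}\mathbf f(\mathbf u^+_{j+\frac12})}{\sigma^+_{j+\frac12}-\sigma^-_{j+\frac12}}+\frac{\sigma^+_{j+\frac12}\sigma^-_{j+\frac12}}{\sigma^+_{j+\frac12}-\sigma^-_{j+\frac12}}\big(\mathbf u^+_{j+\frac12}-\mathbf u^-_{j+\frac12}-\mathbf d_{j+\frac12}\big).$$ Reconstruction: $\mathbf u^-_{j+\frac12}=\overline{\mathbf u}_j^{\,n}+\frac{\Delta x}{2}(\mathbf u_x)_j^n$, $\mathbf u^+_{j+\frac12}=\overline{\mathbf u}_{j+1}^{\,n}-\frac{\Delta x}{2}(\mathbf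 u_x)_{j+1}^n$, with $$(\mathbf u_x)_j^n=\mathrm{minmod}\Big(\theta\tfrac{\overline{\mathbf u}_j^{\,n}-\overline{\mathbf u}_{j-1}^{\,n}}{\Delta x},\tfrac{\overline{\mathbf u}_{j+1}^{\,n}-\overline{\mathbf u}_{j-1}^{\,n}}{2\Delta x},\theta\tfrac{\overline{\mathbf u}_{j+1}^{\,n}-\overline{\mathbf u}_j^{\,n}}{\Delta x}\Big),\quad\theta\in[1,2].$$ Here $\mathrm{minmod}(c_1,c_2,\dots)$ equals $\min\{c_i\}$ if all $c_i>0$, $\max\{c_i\}$ if all $c_i<0$, and $0$ otherwise; it is applied componentwise to vectors. Speeds: $\sigma^-_{j+\frac12}=\min\{\lambda_1(\mathbf u^-_{j+\frac12}),\lambda_1(\mathbf u^+_{j+\frac12}),0\}$, $\sigma^+_{j+\frac12}=\max\{\lambda_m(\mathbf u^-_{j+\frac12}),\lambda_m(\mathbf u^+_{j+\frac12}),0\}$; for those $j$ with $\sigma^+_{j+\frac12}-\sigma^-_{j+\frac12}<\varepsilon$ (a fixed small $\varepsilon>0$) these are replaced by $\sigma^\pm_{j+\frac12}=\pm\varepsilon$. In particular $\sigma^-_{j+\frac12}\le0\le\sigma^+_{j+\frac12}$ and $\sigma^+_{j+\frac12}>\sigma^-_{j+\frac12}$. It is also assumed that $\sigma^+_{j+\frac12}>\sigma^-_{j-\frac12}$ for all $j$, so that $\mathbf u_j^*$ below is well defined. Anti-diffusion: $\mathbf d_{j+\frac12}=\mathrm{minmod}\big(\mathbf u^+_{j+\frac12}-\mathbf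 u^*_{j+\frac12},\,\mathbf u^*_{j+\frac12}-\mathbf u^-_{j+\frac12}\big)$, where $\mathbf u^*_{j+\frac12}=R_f\big(\sigma^+_{j+\frac12},\sigma^-_{j+\frac12},\mathbf u^+_{j+\frac12},\mathbf u^-_{j+\frac12}\big)$ and $$R_f(\sigma^+,\sigma^-,\mathbf u^+,\mathbf u^-):=\frac{\sigma^+\mathbf u^+-\sigma^-\mathbf u^--\mathbf f(\mathbf u^+)+\mathbf f(\mathbf u^-)}{\sigma^+-\sigma^-}.$$ Intermediate states: $$\mathbf u^{*,\pm}_{j+\frac12}:=\mathbf u^*_{j+\frac12}-\frac{\sigma^\pm_{j+\frac12}}{\sigma^+_{j+\frac12}-\sigma^-_{j+\frac12}}\mathbf d_{j+\frac12},\qquad \mathbf u^*_j:=R_f\big(\sigma^+_{j+\frac12},\sigma^-_{j-\frac12},\mathbf u^-_{j+\frac12},\mathbf u^+_{j-\frac12}\big).$$ *)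

theory Defs
  imports "HOL-Analysis.Analysis"
begin

section \<open>Hyperbolic fluxes and extremal characteristic speeds\<close>

definition real_spectrum :: "real^'m^'m \<Rightarrow> real set" where
  "real_spectrum A = {\<mu>. \<exists>v. v \<noteq> 0 \<and> A *v v = \<mu> *\<^sub>R v}"

definition real_diagonalizable :: "real^'m^'m \<Rightarrow> bool" where
  "real_diagonalizable A \<longleftrightarrow>
     (\<exists>(P :: real^'m^'m) (D :: real^'m^'m). invertible P \<and> (\<forall>i k. i \<noteq> k \<longrightarrow> D $ i $ k = 0) \<and> A ** P = P ** D)"

definition hyperbolic_on :: "(real^'m) set \<Rightarrow> (real^'m \<Rightarrow> real^'m) \<Rightarrow> bool" where
  "hyperbolic_on \<Omega> f \<longleftrightarrow>
     (\<forall>u\<in>\<Omega>. f differentiable (at u) \<and> real_diagonalizable (jacobian f (at u)))"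

(* A real diagonalizable Jacobian has a finite nonempty set of real eigenvalues and no others,
   so Min and Max below are taken over genuine finite spectra wherever f is hyperbolic. *)

definition lambda_min :: "(real^'m \<Rightarrow> real^'m) \<Rightarrow> real^'m \<Rightarrow> real" where
  "lambda_min f u = Min (real_spectrum (jacobian f (at u)))"

definition lambda_max :: "(real^'m \<Rightarrow> real^'m) \<Rightarrow> real^'m \<Rightarrow> real" where
  "lambda_max f u = Max (real_spectrum (jacobian f (at u)))"


section \<open>The minmod function\<close>

definition minmod :: "real list \<Rightarrow> real" where
  "minmod cs = (if \<forall>c\<in>set cs. 0 < c then Min (set cs)
                else if \<forall>c\<in>set cs. c < 0 then Max (set cs)
                else 0)"

definition minmod_vec :: "(real^'m) list \<Rightarrow> real^'m" where
  "minmod_vec cs = (\<chi> i. minmod (map (\<lambda>c. c $ i) cs))"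


section \<open>The central-upwind scheme\<close>

(* Cells are numbered by the integers.  A quantity living at the interface x_{j+1/2} is indexed
   by j, so the interface x_{j-1/2} has index j - 1.  The argument ub is the family of
   cell averages at time level n. *)

definition slope :: "real \<Rightarrow> real \<Rightarrow> (int \<Rightarrow> real^'m) \<Rightarrow> int \<Rightarrow> real^'m" where
  "slope \<theta> \<Delta>x ub j = minmod_vec
     [(\<theta> / \<Delta>x) *\<^sub>R (ub j - ub (j - 1)),
      (1 / (2 * \<Delta>x)) *\<^sub>R (ub (j + 1) - ub (j - 1)),
      (\<theta> / \<Delta>x) *\<^sub>R (ub (j + 1) - ub j)]"

definition u_minus :: "real \<Rightarrow> real \<Rightarrow> (int \<Rightarrow> real^'m) \<Rightarrow> int \<Rightarrow> real^'m" where
  "u_minus \<theta> \<Delta>x ub j = ub j + (\<Delta>x / 2) *\<^sub>R slope \<theta> \<Delta>x ub j"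

definition u_plus :: "real \<Rightarrow> real \<Rightarrow> (int \<Rightarrow> real^'m) \<Rightarrow> int \<Rightarrow> real^'m" where
  "u_plus \<theta> \<Delta>x ub j = ub (j + 1) - (\<Delta>x / 2) *\<^sub>R slope \<theta> \<Delta>x ub (j + 1)"

definition raw_speed_minus :: "(real^'m \<Rightarrow> real^'m) \<Rightarrow> real^'m \<Rightarrow> real^'m \<Rightarrow> real" where
  "raw_speed_minus f um up = Min {lambda_min f um, lambda_min f up, 0}"

definition raw_speed_plus :: "(real^'m \<Rightarrow> real^'m) \<Rightarrow> real^'m \<Rightarrow> real^'m \<Rightarrow> real" where
  "raw_speed_plus f um up = Max {lambda_max f um, lambda_max f up, 0}"

definition speed_minus :: "real \<Rightarrow> (real^'m \<Rightarrow> real^'m) \<Rightarrow> real^'m \<Rightarrow> real^'m \<Rightarrow> real" where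
  "speed_minus \<epsilon> f um up =
     (if raw_speed_plus f um up - raw_speed_minus f um up < \<epsilon> then - \<epsilon>
      else raw_speed_minus f um up)"

definition speed_plus :: "real \<Rightarrow> (real^'m \<Rightarrow> real^'m) \<Rightarrow> real^'m \<Rightarrow> real^'m \<Rightarrow> real" where
  "speed_plus \<epsilon> f um up =
     (if raw_speed_plus f um up - raw_speed_minus f um up < \<epsilon> then \<epsilon>
      else raw_speed_plus f um up)"

(* The argument order is that of R_f(sigma^+, sigma^-, u^+, u^-). *)
definition R_f :: "(real^'m \<Rightarrow> real^'m) \<Rightarrow> real \<Rightarrow> real \<Rightarrow> real^'m \<Rightarrow> real^'m \<Rightarrow> real^'m" where
  "R_f f sp sm up um = (1 / (sp - sm)) *\<^sub>R (sp *\<^sub>R up - sm *\<^sub>R um - f up + f um)"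

definition anti_diffusion :: "real^'m \<Rightarrow> real^'m \<Rightarrow> real^'m \<Rightarrow> real^'m" where
  "anti_diffusion um us up = minmod_vec [up - us, us - um]"

definition cu_flux ::
  "(real^'m \<Rightarrow> real^'m) \<Rightarrow> real \<Rightarrow> real \<Rightarrow> real^'m \<Rightarrow> real^'m \<Rightarrow> real^'m \<Rightarrow> real^'m" where
  "cu_flux f sp sm up um d =
     (1 / (sp - sm)) *\<^sub>R (sp *\<^sub>R f um - sm *\<^sub>R f up)
     + (sp * sm / (sp - sm)) *\<^sub>R (up - um - d)"

definition cu_numerical_flux ::
  "real \<Rightarrow> real \<Rightarrow> (real^'m \<Rightarrow> real^'m) \<Rightarrow> real \<Rightarrow> (int \<Rightarrow> real^'m) \<Rightarrow> int \<Rightarrow> real^'m" where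
  "cu_numerical_flux \<epsilon> \<theta> f \<Delta>x ub j =
     (let um = u_minus \<theta> \<Delta>x ub j;
          up = u_plus \<theta> \<Delta>x ub j;
          sm = speed_minus \<epsilon> f um up;
          sp = speed_plus \<epsilon> f um up
      in cu_flux f sp sm up um (anti_diffusion um (R_f f sp sm up um) up))"

definition cu_step ::
  "real \<Rightarrow> real \<Rightarrow> (real^'m \<Rightarrow> real^'m) \<Rightarrow> real \<Rightarrow> real \<Rightarrow> (int \<Rightarrow> real^'m) \<Rightarrow> int \<Rightarrow> real^'m" where
  "cu_step \<epsilon> \<theta> f \<Delta>x \<Delta>t ub j =
     ub j - (\<Delta>t / \<Delta>x) *\<^sub>R
       (cu_numerical_flux \<epsilon> \<theta> f \<Delta>x ub j - cu_numerical_flux \<epsilon> \<theta> f \<Delta>x ub (j - 1))"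

end

theory Submission
  imports Defs
begin

text \<open>
  The numerical flux at an interface can be written both as
  \<open>f u\<^sup>- + \<sigma>\<^sup>- (u\<^sup>*\<^sup>+ - u\<^sup>-)\<close> and as \<open>f u\<^sup>+ + \<sigma>\<^sup>+ (u\<^sup>*\<^sup>- - u\<^sup>+)\<close>.
  Using the first form at the right interface of a cell and the second at the left one, the two
  remaining flux values inside the cell are absorbed by the cell state \<open>u\<^sup>*\<^sub>j\<close>, and the cell
  average is the mean of the two reconstructed values.
\<close>

lemma speed_minus_nonpos: "0 < \<epsilon> \<Longrightarrow> speed_minus \<epsilon> f um up \<le> 0"
  by (simp add: speed_minus_def raw_speed_minus_def min_le_iff_disj)

lemma speed_plus_nonneg: "0 < \<epsilon> \<Longrightarrow> 0 \<le> speed_plus \<epsilon> f um up"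
  by (simp add: speed_plus_def raw_speed_plus_def le_max_iff_disj)

lemma speed_minus_less_plus: "0 < \<epsilon> \<Longrightarrow> speed_minus \<epsilon> f um up < speed_plus \<epsilon> f um up"
  by (simp add: speed_minus_def speed_plus_def)

lemma scaleR_R_f:
  assumes "sp \<noteq> sm"
  shows "(sp - sm) *\<^sub>R R_f f sp sm up um = sp *\<^sub>R up - sm *\<^sub>R um - f up + f um"
  using assms by (simp add: R_f_def)

text \<open>At \<open>d = 0\<close> this is the Rankine-Hugoniot condition of the HLL flux across
  the wave of speed \<open>sm\<close>, which separates \<open>um\<close> from the intermediate
  state. Subtracting \<open>(sp / (sp - sm)) *\<^sub>R d\<close> from that state contributes exactly
  the term in \<open>d\<close> of \<open>cu_flux\<close>.\<close>

lemma cu_flux_eq_left: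
  assumes "sp \<noteq> sm"
  shows "cu_flux f sp sm up um d =
    f um + sm *\<^sub>R (R_f f sp sm up um - (sp / (sp - sm)) *\<^sub>R d - um)"
  using assms by (simp add: vec_eq_iff cu_flux_def R_f_def divide_simps) (simp add: algebra_simps)

text \<open>The mirror image across the wave of speed \<open>sp\<close>: the weights of
  \<open>d\<close> in the two intermediate states are chosen so that both forms carry the same
  multiple of \<open>d\<close>.\<close>

lemma cu_flux_eq_right:
  assumes "sp \<noteq> sm"
  shows "cu_flux f sp sm up um d =
    f up + sp *\<^sub>R (R_f f sp sm up um - (sm / (sp - sm)) *\<^sub>R d - up)"
  using assms by (simp add: vec_eq_iff cu_flux_def R_f_def divide_simps) (simp add: algebra_simps)

text \<open>The right trace at interface \<open>j - 1\<close> uses the slope of cell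
  \<open>j\<close>, so both values lie on one linear piece, at equal distances from the cell centre,
  and the slope cancels.\<close>

lemma cell_average_eq_mean:
  "ub j = (1/2) *\<^sub>R u_plus \<theta> \<Delta>x ub (j - 1) + (1/2) *\<^sub>R u_minus \<theta> \<Delta>x ub j"
  by (simp add: vec_eq_iff u_plus_def u_minus_def field_simps)

text \<open>The maximum over all interfaces is modelled by a supremum over an infinite index set;
  boundedness makes it a genuine upper bound of every term.\<close>

lemma SUP_CFL_bound:
  fixes g :: "'a \<Rightarrow> real"
  assumes "bdd_above (range g)" "0 \<le> c" "c * (SUP i. g i) \<le> b"
  shows "c * g i \<le> b"
  using assms by (meson UNIV_I cSUP_upper mult_left_mono order_trans)

theorem theorem2p3:
  fixes \<Omega> :: "(real^'m) set" and f :: "real^'m \<Rightarrow> real^'m"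
    and \<Delta>x \<Delta>t \<theta> \<epsilon> lam :: real
    and ub um up us d us_plus us_minus us_cell :: "int \<Rightarrow> real^'m"
    and sm sp :: "int \<Rightarrow> real"
  defines "lam \<equiv> \<Delta>t / \<Delta>x"
    and "um \<equiv> u_minus \<theta> \<Delta>x ub"
    and "up \<equiv> u_plus \<theta> \<Delta>x ub"
    and "sm \<equiv> \<lambda>j. speed_minus \<epsilon> f (um j) (up j)"
    and "sp \<equiv> \<lambda>j. speed_plus \<epsilon> f (um j) (up j)"
    and "us \<equiv> \<lambda>j. R_f f (sp j) (sm j) (up j) (um j)"
    and "d \<equiv> \<lambda>j. anti_diffusion (um j) (us j) (up j)"
    and "us_plus \<equiv> \<lambda>j. us j - (sp j / (sp j - sm j)) *\<^sub>R d j"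
    and "us_minus \<equiv> \<lambda>j. us j - (sm j / (sp j - sm j)) *\<^sub>R d j"
    and "us_cell \<equiv> \<lambda>j. R_f f (sp j) (sm (j - 1)) (um j) (up (j - 1))"
  assumes "hyperbolic_on \<Omega> f"
    and "\<And>j. um j \<in> \<Omega>" and "\<And>j. up j \<in> \<Omega>"
    and "0 < \<Delta>x" and "0 < \<Delta>t" and "0 < \<epsilon>" and "1 \<le> \<theta>" and "\<theta> \<le> 2"
    and "\<And>j. sm (j - 1) < sp j"
  shows "(\<forall>j. cu_step \<epsilon> \<theta> f \<Delta>x \<Delta>t ub j =
            (1/2 - lam * (sp (j - 1) - sm (j - 1))) *\<^sub>R up (j - 1)
          + (lam * sp (j - 1)) *\<^sub>R us_minus (j - 1)
          + (1/2 - lam * (sp j - sm j)) *\<^sub>R um j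
          + (- (lam * sm j)) *\<^sub>R us_plus j
          + (lam * (sp j - sm (j - 1))) *\<^sub>R us_cell j)
       \<and> (bdd_above (range (\<lambda>j. sp j - sm j)) \<and> lam * (SUP j. sp j - sm j) \<le> 1/2 \<longrightarrow>
          (\<forall>j. 0 \<le> 1/2 - lam * (sp (j - 1) - sm (j - 1))
             \<and> 0 \<le> lam * sp (j - 1)
             \<and> 0 \<le> 1/2 - lam * (sp j - sm j)
             \<and> 0 \<le> - (lam * sm j)
             \<and> 0 \<le> lam * (sp j - sm (j - 1))
             \<and> (1/2 - lam * (sp (j - 1) - sm (j - 1))) + lam * sp (j - 1)
               + (1/2 - lam * (sp j - sm j)) + (- (lam * sm j))
               + lam * (sp j - sm (j - 1)) = 1))"
proof (intro conjI impI allI)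
  have less: "sm j < sp j" for j
    unfolding sm_def sp_def by (rule speed_minus_less_plus[OF \<open>0 < \<epsilon>\<close>])
  have sm0: "sm j \<le> 0" and sp0: "0 \<le> sp j" for j
    unfolding sm_def sp_def using \<open>0 < \<epsilon>\<close> by (rule speed_minus_nonpos, rule speed_plus_nonneg)
  have lam0: "0 \<le> lam"
    using \<open>0 < \<Delta>x\<close> \<open>0 < \<Delta>t\<close> by (simp add: lam_def)
  {
    fix j
    define F where "F = cu_numerical_flux \<epsilon> \<theta> f \<Delta>x ub"
    have F: "F k = cu_flux f (sp k) (sm k) (up k) (um k) (d k)" for k
      by (simp add: F_def cu_numerical_flux_def Let_def d_def us_def sp_def sm_def up_def um_def)
    have right: "F j = f (um j) + sm j *\<^sub>R (us_plus j - um j)"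
      unfolding F us_plus_def us_def by (rule cu_flux_eq_left) (use less[of j] in simp)
    have left: "F (j - 1) = f (up (j - 1)) + sp (j - 1) *\<^sub>R (us_minus (j - 1) - up (j - 1))"
      unfolding F us_minus_def us_def by (rule cu_flux_eq_right) (use less[of "j - 1"] in simp)
    \<comment> \<open>The coefficient of the cell state is the denominator of its
      \<open>R_f\<close>, up to \<open>lam\<close>. Clearing it leaves
      \<open>f (up (j - 1)) - f (um j)\<close>, the two flux values that \<open>left\<close> and
      \<open>right\<close> contribute.\<close>
    have cell: "(lam * (sp j - sm (j - 1))) *\<^sub>R us_cell j =
        lam *\<^sub>R (sp j *\<^sub>R um j - sm (j - 1) *\<^sub>R up (j - 1) - f (um j) + f (up (j - 1)))"
      using scaleR_R_f[of "sp j" "sm (j - 1)" f "um j" "up (j - 1)"] \<open>\<And>j. sm (j - 1) < sp j\<close>[of j]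
      by (simp add: us_cell_def flip: scaleR_scaleR)
    have "cu_step \<epsilon> \<theta> f \<Delta>x \<Delta>t ub j =
        (1/2) *\<^sub>R up (j - 1) + (1/2) *\<^sub>R um j - lam *\<^sub>R (F j - F (j - 1))"
      unfolding cu_step_def F_def lam_def up_def um_def by (simp flip: cell_average_eq_mean)
    then show "cu_step \<epsilon> \<theta> f \<Delta>x \<Delta>t ub j =
            (1/2 - lam * (sp (j - 1) - sm (j - 1))) *\<^sub>R up (j - 1)
          + (lam * sp (j - 1)) *\<^sub>R us_minus (j - 1)
          + (1/2 - lam * (sp j - sm j)) *\<^sub>R um j
          + (- (lam * sm j)) *\<^sub>R us_plus j
          + (lam * (sp j - sm (j - 1))) *\<^sub>R us_cell j"
      \<comment> \<open>The values of \<open>f\<close> cancel. What remains is comparing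
        coefficients: \<open>um j\<close> has \<open>1/2 + lam * sm j\<close> on both sides, and
        \<open>up (j - 1)\<close> has \<open>1/2 - lam * sp (j - 1)\<close>.\<close>
      unfolding cell left right by (simp add: vec_eq_iff algebra_simps)
  }
  assume CFL: "bdd_above (range (\<lambda>j. sp j - sm j)) \<and> lam * (SUP j. sp j - sm j) \<le> 1/2"
  have bound: "0 \<le> 1/2 - lam * (sp j - sm j)" for j
    using SUP_CFL_bound[of "\<lambda>j. sp j - sm j" lam "1/2" j] CFL lam0 by simp
  fix j
  show "0 \<le> 1/2 - lam * (sp (j - 1) - sm (j - 1))" "0 \<le> 1/2 - lam * (sp j - sm j)"
    by (rule bound)+
  show "0 \<le> lam * sp (j - 1)" "0 \<le> - (lam * sm j)"
    using lam0 sp0 sm0 by (simp_all add: mult_nonneg_nonpos)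
  show "0 \<le> lam * (sp j - sm (j - 1))"
    using lam0 sp0[of j] sm0[of "j - 1"] by simp
  show "(1/2 - lam * (sp (j - 1) - sm (j - 1))) + lam * sp (j - 1)
        + (1/2 - lam * (sp j - sm j)) + (- (lam * sm j)) + lam * (sp j - sm (j - 1)) = 1"
    by (simp add: algebra_simps)
qed

end
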